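(* Let $\mathcal{G}=(\mathcal{V},\mathcal{E},W)$ be a finite undirected weighted graph, $\mathcal{V}=\{1,\dots,n\}$, with edge weights $w_{i,j}\ge 0$, and let $M\subseteq\mathcal{E}$ be a matching. Let $t\mapsto\alpha^b(t)$ be a trajectory of the dynamics $\dot\alpha^b=-e^b(\alpha^b)$ starting from an initial point in $\mathbb{R}^n$, where $e^b$ is the vector of balancing errors associated with $M$. Then $t\mapsto(M,\alpha^b(t))$ converges to a balanced outcome; that is, $\alpha^b(t)$ converges as $t\to\infty$ to some $\alpha^{b,*}\in\mathbb{R}^n$ such that $(M,\alpha^{b,*})$ is a balanced outcome. Moreover, the dynamics $\dot\alpha^b=-e^b(\alpha^b)$ is distributed with respect to $2$-hop neighborhoods over $\mathcal{G}$.
   Context: Graph: edges join distinct vertices and are undirected, $w_{i,j}=w_{j,i}$; $\mathcal{N}(i)=\{j:(i,j)\in\mathcal{E}\}$. A matching is a set of edges without common vertices; a vertex is matched if it belongs to an edge of $M$. For $(i,j)\in\mathcal{E}$ and $\alpha\in\mathbb{R}^n$, the best allocation of $i$ outside $j$ is $$\mathrm{ba}_{i\setminus j}(\alpha)=\max_{k\in\mathcal{N}(i)\setminus\{j\}}\max\{0,w_{i,k}-\alpha_k\},$$ equal to $0$ if $\mathcal{N}(i)\setminus\{j\}=\emptyset$. An outcome is a pair $(M,\alpha)$ with $M$ a matching and $\alpha\in\mathbb{R}^n$ such that $\alpha_i+\alpha_j=w_{i,j}$ if $(i,j)\in M$ and $\alpha_k=0$ if $k$ is in no edge of $M$. An outcome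 is balanced if $\mathrm{ba}_{i\setminus j}(\alpha)-\alpha_i=\mathrm{ba}_{j\setminus i}(\alpha)-\alpha_j$ for all $(i,j)\in M$. Balancing errors $e^b:\mathbb{R}^n\to\mathbb{R}^n$ associated with $M$: if $i$ is matched to $j$, i.e. $(i,j)\in M$, $$e^b_i(\alpha)=\alpha_i-\tfrac12\big(w_{i,j}+\mathrm{ba}_{i\setminus j}(\alpha)-\mathrm{ba}_{j\setminus i}(\alpha)\big),$$ and $e^b_k(\alpha)=\alpha_k$ if $k$ is unmatched. A dynamics is distributed with respect to $2$-hop neighborhoods over $\mathcal{G}$ if the right-hand side of the equation for the state of each agent $i$ (here $\alpha^b_i$) depends only on $i$'s own state, the states of its $1$- and $2$-hop neighbors in $\mathcal{G}$, and the weights $w_{i,j}$ and $w_{j,k}$ for $j\in\mathcal{N}(i)$, $k\in\mathcal{N}(j)$ (the matching $M$ is given: each agent knows whether it is matched and with whom). *)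

theory Defs
  imports "HOL-Analysis.Analysis"
begin

text \<open>
  The vertex set is the finite type \<open>'n\<close>. Edges are unordered pairs \<open>{i, j}\<close>, so the graph is
  undirected, and the cardinality condition excludes loops. The values of \<open>w\<close> off the edges are
  irrelevant.
\<close>

definition weighted_graph :: "'n::finite set set \<Rightarrow> ('n \<Rightarrow> 'n \<Rightarrow> real) \<Rightarrow> bool" where
  "weighted_graph E w \<longleftrightarrow>
     (\<forall>e\<in>E. card e = 2) \<and>
     (\<forall>i j. {i, j} \<in> E \<longrightarrow> w i j = w j i \<and> 0 \<le> w i j)"

definition neighbors :: "'n::finite set set \<Rightarrow> 'n \<Rightarrow> 'n set" where
  "neighbors E i = {j. {i, j} \<in> E}"

definition is_matching :: "'n::finite set set \<Rightarrow> 'n set set \<Rightarrow> bool" where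
  "is_matching E M \<longleftrightarrow> M \<subseteq> E \<and> pairwise disjnt M"

definition best_allocation ::
    "'n::finite set set \<Rightarrow> ('n \<Rightarrow> 'n \<Rightarrow> real) \<Rightarrow> 'n \<Rightarrow> 'n \<Rightarrow> real^'n \<Rightarrow> real" where
  "best_allocation E w i j \<alpha> =
     (if neighbors E i - {j} = {} then 0
      else Max ((\<lambda>k. max 0 (w i k - \<alpha> $ k)) ` (neighbors E i - {j})))"

definition outcome ::
    "'n::finite set set \<Rightarrow> ('n \<Rightarrow> 'n \<Rightarrow> real) \<Rightarrow> 'n set set \<Rightarrow> real^'n \<Rightarrow> bool" where
  "outcome E w M \<alpha> \<longleftrightarrow>
     is_matching E M \<and>
     (\<forall>i j. {i, j} \<in> M \<longrightarrow> \<alpha> $ i + \<alpha> $ j = w i j) \<and>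
     (\<forall>k. k \<notin> \<Union>M \<longrightarrow> \<alpha> $ k = 0)"

definition balanced_outcome ::
    "'n::finite set set \<Rightarrow> ('n \<Rightarrow> 'n \<Rightarrow> real) \<Rightarrow> 'n set set \<Rightarrow> real^'n \<Rightarrow> bool" where
  "balanced_outcome E w M \<alpha> \<longleftrightarrow>
     outcome E w M \<alpha> \<and>
     (\<forall>i j. {i, j} \<in> M \<longrightarrow>
        best_allocation E w i j \<alpha> - \<alpha> $ i = best_allocation E w j i \<alpha> - \<alpha> $ j)"

text \<open>Only meaningful if \<open>M\<close> is a matching and \<open>i\<close> is matched; the partner is then unique.\<close>

definition partner :: "'n::finite set set \<Rightarrow> 'n \<Rightarrow> 'n" where
  "partner M i = (THE j. {i, j} \<in> M)"

definition balancing_error ::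
    "'n::finite set set \<Rightarrow> ('n \<Rightarrow> 'n \<Rightarrow> real) \<Rightarrow> 'n set set \<Rightarrow> real^'n \<Rightarrow> real^'n" where
  "balancing_error E w M \<alpha> =
     (\<chi> i. if i \<in> \<Union>M
           then let j = partner M i
                in \<alpha> $ i - 1/2 * (w i j + best_allocation E w i j \<alpha> - best_allocation E w j i \<alpha>)
           else \<alpha> $ i)"

text \<open>The derivative is one-sided at the initial time \<open>0\<close>.\<close>

definition trajectory :: "(real^'n::finite \<Rightarrow> real^'n) \<Rightarrow> real^'n \<Rightarrow> (real \<Rightarrow> real^'n) \<Rightarrow> bool" where
  "trajectory f x0 x \<longleftrightarrow>
     x 0 = x0 \<and> (\<forall>t\<ge>0. (x has_vector_derivative f (x t)) (at t within {0..}))"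

definition two_hop_neighbors :: "'n::finite set set \<Rightarrow> 'n \<Rightarrow> 'n set" where
  "two_hop_neighbors E i = (\<Union>j\<in>neighbors E i. neighbors E j)"

text \<open>
  To express that a right-hand side depends only on certain data, the dynamics is given as a
  family \<open>F w M\<close> of vector fields over the fixed graph \<open>E\<close>, indexed by the weights and the matching.
  The component of agent \<open>i\<close> must not change if the weights, the matching and the state are replaced
  by others that agree in the data available to \<open>i\<close>. Of the matching, \<open>i\<close> knows only whether it is
  matched and with whom.
\<close>

definition distributed_two_hop ::
    "'n::finite set set \<Rightarrow> (('n \<Rightarrow> 'n \<Rightarrow> real) \<Rightarrow> 'n set set \<Rightarrow> real^'n \<Rightarrow> real^'n) \<Rightarrow> bool" where
  "distributed_two_hop E F \<longleftrightarrow>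
     (\<forall>i w w' M M' \<alpha> \<alpha>'.
        weighted_graph E w \<longrightarrow> weighted_graph E w' \<longrightarrow>
        is_matching E M \<longrightarrow> is_matching E M' \<longrightarrow>
        (\<forall>j\<in>neighbors E i. w i j = w' i j \<and> (\<forall>k\<in>neighbors E j. w j k = w' j k)) \<longrightarrow>
        (\<forall>j. {i, j} \<in> M \<longleftrightarrow> {i, j} \<in> M') \<longrightarrow>
        (\<forall>k \<in> {i} \<union> neighbors E i \<union> two_hop_neighbors E i. \<alpha> $ k = \<alpha>' $ k) \<longrightarrow>
        F w M \<alpha> $ i = F w' M' \<alpha>' $ i)"

end

theory Submission
  imports Defs
begin

text \<open>
  Write the dynamics as \<open>x' = T x - x\<close> with \<open>T x = x - balancing_error E w M x\<close>. Best allocations are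
  nonexpansive for the maximum norm and enter \<open>T\<close> as half a difference, so \<open>T\<close> is nonexpansive, and
  because they are nonnegative, \<open>T\<close> maps a large cube into itself. Brouwer's theorem gives a fixed
  point; the fixed points of \<open>T\<close> are balanced outcomes. For any nonexpansive \<open>T\<close>, distances between
  trajectories and the speed of a trajectory are nonincreasing, and a Goebel--Kirk inequality shows
  that a positive limit speed would force an unbounded displacement. Hence the speed tends to \<open>0\<close>,
  a cluster point is a fixed point, and the distance to it decreases to \<open>0\<close>.
\<close>

section \<open>Maximum norm\<close>

text \<open>A signed basis vector is a norming functional. It replaces the nonsmooth maximum norm
  along a trajectory by a differentiable scalar function of the form
  \<open>x t \<bullet> u\<close>.\<close>

lemma infnorm_attained:
  fixes v :: "'a::euclidean_space"
  obtains u where "v \<bullet> u = infnorm v" and "\<And>z. \<bar>z \<bullet> u\<bar> \<le> infnorm z"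
proof -
  have "infnorm v \<in> (\<lambda>i. \<bar>v \<bullet> i\<bar>) ` Basis"
    unfolding infnorm_Max by (intro Max_in) auto
  then obtain b where b: "b \<in> Basis" "infnorm v = \<bar>v \<bullet> b\<bar>" by auto
  show thesis
  proof (cases "v \<bullet> b \<ge> 0")
    case True
    with b show thesis by (intro that[of b]) (auto simp: Basis_le_infnorm)
  next
    case False
    with b show thesis by (intro that[of "- b"]) (auto simp: Basis_le_infnorm)
  qed
qed

lemma continuous_on_infnorm_Lipschitz:
  fixes f :: "'a::euclidean_space \<Rightarrow> 'b::euclidean_space"
  assumes "\<And>x y. infnorm (f x - f y) \<le> infnorm (x - y)"
  shows "continuous_on S f"
proof -
  have "dist (f x) (f y) \<le> sqrt DIM('b) * dist x y" for x y
  proof -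
    have "norm (f x - f y) \<le> sqrt DIM('b) * infnorm (f x - f y)" by (rule norm_le_infnorm)
    also have "\<dots> \<le> sqrt DIM('b) * norm (x - y)"
      using assms[of x y] infnorm_le_norm[of "x - y"] by (intro mult_left_mono) auto
    finally show ?thesis by (simp add: dist_norm)
  qed
  then have "(sqrt DIM('b))-lipschitz_on S f" by (auto intro!: lipschitz_onI)
  then show ?thesis by (rule lipschitz_on_continuous_on)
qed

section \<open>Flows of nonexpansive maps\<close>

locale nonexpansive_flow =
  fixes T :: "'a::euclidean_space \<Rightarrow> 'a" and x :: "real \<Rightarrow> 'a"
  assumes nonexpansive: "infnorm (T y - T z) \<le> infnorm (y - z)"
    and flow: "t \<ge> 0 \<Longrightarrow> (x has_vector_derivative T (x t) - x t) (at t within {0..})"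
begin

lemma continuous_on_flow: "continuous_on {0..} x"
  using flow by (auto intro!: has_vector_derivative_continuous simp: continuous_on_eq_continuous_within)

lemma flow_inner:
  assumes "t > 0"
  shows "((\<lambda>t. x t \<bullet> u) has_real_derivative (T (x t) - x t) \<bullet> u) (at t)"
proof -
  have "(x has_vector_derivative T (x t) - x t) (at t)"
    using flow[of t] assms at_within_interior[of t "{0::real..}"] by auto
  then show ?thesis
    by (auto simp: has_vector_derivative_def has_field_derivative_def mult.commute[of _ "_ \<bullet> _"]
        intro!: derivative_eq_intros)
qed

lemma shift: "c \<ge> 0 \<Longrightarrow> nonexpansive_flow T (\<lambda>t. x (t + c))"
proof (unfold_locales, rule nonexpansive)
  fix t :: real assume "c \<ge> 0" "t \<ge> 0"
  have "(x \<circ> (\<lambda>t. t + c) has_vector_derivative 1 *\<^sub>R (T (x (t + c)) - x (t + c))) (at t within {0..})"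
    using \<open>c \<ge> 0\<close> \<open>t \<ge> 0\<close>
    by (intro vector_diff_chain_within has_vector_derivative_within_subset[OF flow])
       (auto intro!: derivative_eq_intros)
  then show "((\<lambda>t. x (t + c)) has_vector_derivative T (x (t + c)) - x (t + c)) (at t within {0..})"
    by (simp add: o_def)
qed

text \<open>Take a time \<open>s\<close> in the interval at which the distance reaches its maximum
  \<open>m\<close>, and a norming functional \<open>u\<close> there. Comparing the component along
  \<open>u\<close> at \<open>a\<close> and at \<open>s\<close> shows that the distance at
  \<open>a\<close> is already at least \<open>m\<close>.\<close>

lemma infnorm_diff_antimono:
  assumes "nonexpansive_flow T y" "0 \<le> a" "a \<le> b"
  shows "infnorm (x b - y b) \<le> infnorm (x a - y a)"
proof -
  interpret y: nonexpansive_flow T y by fact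
  have cx: "continuous_on {a..c} x" and cy: "continuous_on {a..c} y" for c
    using continuous_on_flow y.continuous_on_flow assms by (auto elim: continuous_on_subset)
  obtain s where s: "s \<in> {a..b}" "\<And>t. t \<in> {a..b} \<Longrightarrow> infnorm (x t - y t) \<le> infnorm (x s - y s)"
    using continuous_attains_sup[of "{a..b}" "\<lambda>t. infnorm (x t - y t)",
        OF _ _ continuous_on_infnorm[OF continuous_on_diff[OF cx cy]]] assms(3)
    by auto
  define m where "m = infnorm (x s - y s)"
  obtain u where u: "(x s - y s) \<bullet> u = m" "\<And>z. \<bar>z \<bullet> u\<bar> \<le> infnorm z"
    unfolding m_def using infnorm_attained by blast
  \<comment> \<open>The factor \<open>exp t\<close> absorbs the linear term of the flow: the
    derivative becomes \<open>exp t * (m - (T (x t) - T (y t)) \<bullet> u)\<close>, nonnegative by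
    nonexpansiveness and maximality of \<open>m\<close>. The right-hand side is 0 by the choice of
    \<open>u\<close>.\<close>
  have "exp a * (m - (x a - y a) \<bullet> u) \<le> exp s * (m - (x s - y s) \<bullet> u)"
  proof (rule DERIV_nonneg_imp_increasing_open[of a s "\<lambda>t. exp t * (m - (x t - y t) \<bullet> u)"])
    show "a \<le> s" using s by simp
    fix t assume t: "a < t" "t < s"
    have "((\<lambda>t. exp t * (m - (x t \<bullet> u - y t \<bullet> u))) has_real_derivative
             exp t * (m - (T (x t) - T (y t)) \<bullet> u)) (at t)"
      using t assms(2)
      by (auto intro!: derivative_eq_intros flow_inner y.flow_inner simp: algebra_simps)
    moreover have "(T (x t) - T (y t)) \<bullet> u \<le> m"
      using u(2)[of "T (x t) - T (y t)"] nonexpansive[of "x t" "y t"] s(2)[of t] t s(1)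
      by (auto simp: m_def)
    ultimately show "\<exists>D. ((\<lambda>t. exp t * (m - (x t - y t) \<bullet> u)) has_real_derivative D) (at t) \<and> D \<ge> 0"
      by (auto simp: inner_diff_left)
  qed (intro continuous_intros cx cy)
  then have "m \<le> (x a - y a) \<bullet> u" using u(1) by (simp add: mult_le_0_iff)
  then show ?thesis
    using u(2)[of "x a - y a"] s(2)[of b] assms by (auto simp: m_def)
qed

text \<open>The equation is autonomous, so the trajectory shifted by \<open>h\<close> is again a
  trajectory. Its distance to the original one, divided by \<open>h\<close>, is nonincreasing and
  tends to the speed as \<open>h\<close> tends to 0.\<close>

lemma speed_antimono:
  assumes "0 \<le> a" "a \<le> b"
  shows "infnorm (T (x b) - x b) \<le> infnorm (T (x a) - x a)"
proof -
  \<comment> \<open>Quotients from the right make this valid at the initial time as well.\<close>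
  have lim: "((\<lambda>h. infnorm ((x (h + c) - x c) /\<^sub>R h)) \<longlongrightarrow> infnorm (T (x c) - x c)) (at_right 0)"
    if "c \<ge> 0" for c
  proof -
    interpret s: nonexpansive_flow T "\<lambda>t. x (t + c)" using shift that .
    have "((\<lambda>t. x (t + c)) has_vector_derivative T (x c) - x c) (at 0 within {0..})"
      using s.flow[of 0] by simp
    then have "((\<lambda>t. x (t + c)) has_vector_derivative T (x c) - x c) (at_right 0)"
      by (rule has_vector_derivative_within_subset) auto
    then have "((\<lambda>h. (x (h + c) - x c - h *\<^sub>R (T (x c) - x c)) /\<^sub>R norm h) \<longlongrightarrow> 0) (at_right 0)"
      by (simp add: has_vector_derivative_def has_derivative_at_within)
    then have "((\<lambda>h. (x (h + c) - x c) /\<^sub>R h - (T (x c) - x c)) \<longlongrightarrow> 0) (at_right 0)"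
      by (rule Lim_transform_eventually)
         (auto simp: eventually_at_filter scaleR_diff_right intro!: always_eventually)
    then show ?thesis
      by (intro tendsto_infnorm) (rule LIM_zero_cancel)
  qed
  have "infnorm ((x (h + b) - x b) /\<^sub>R h) \<le> infnorm ((x (h + a) - x a) /\<^sub>R h)" if "h > 0" for h
  proof -
    have "infnorm (x b - x (b + h)) \<le> infnorm (x a - x (a + h))"
      using infnorm_diff_antimono[OF shift[of h] assms] that by simp
    then show ?thesis using that
      by (simp add: infnorm_mul infnorm_sub[of "x (_ + h)"] add.commute[of h] divide_right_mono)
  qed
  then show ?thesis
    using assms by (intro tendsto_le[OF _ lim lim]) (auto simp: eventually_at_filter)
qed

text \<open>A continuous-time version of the Goebel--Kirk inequality for averaged iterations.\<close>

lemma displacement_ge: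
  assumes "0 \<le> a" "a \<le> b"
  defines "d \<equiv> \<lambda>t. infnorm (T (x t) - x t)"
  shows "d a * (b - a) - exp (b - a) * (d a - d b) \<le> infnorm (x b - x a)"
proof -
  define L where "L = d a"
  \<comment> \<open>The displacement is measured along the direction that norms the final
    velocity.\<close>
  obtain u where u: "(T (x b) - x b) \<bullet> u = d b" "\<And>z. \<bar>z \<bullet> u\<bar> \<le> infnorm z"
    unfolding d_def using infnorm_attained by blast
  have cx: "continuous_on {a..b} x" for b
    using continuous_on_flow assms by (auto elim: continuous_on_subset)
  have Lip: "infnorm (x b - x t) \<le> L * (b - t)" if "t \<in> {a..b}" for t
  proof -
    obtain v where v: "(x b - x t) \<bullet> v = infnorm (x b - x t)" "\<And>z. \<bar>z \<bullet> v\<bar> \<le> infnorm z"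
      using infnorm_attained by blast
    have "L * t - x t \<bullet> v \<le> L * b - x b \<bullet> v"
    proof (rule DERIV_nonneg_imp_increasing_open[of t b "\<lambda>t. L * t - x t \<bullet> v"])
      fix s assume s: "t < s" "s < b"
      have "((\<lambda>t. L * t - x t \<bullet> v) has_real_derivative L - (T (x s) - x s) \<bullet> v) (at s)"
        using s that assms(1) by (auto intro!: derivative_eq_intros flow_inner)
      moreover have "(T (x s) - x s) \<bullet> v \<le> L"
        using v(2)[of "T (x s) - x s"] speed_antimono[of a s] s that assms(1) by (auto simp: L_def d_def)
      ultimately show "\<exists>D. ((\<lambda>t. L * t - x t \<bullet> v) has_real_derivative D) (at s) \<and> D \<ge> 0" by auto
    qed (use that in \<open>auto intro!: continuous_intros continuous_on_subset[OF cx[of b]]\<close>)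
    then show ?thesis using v(1) by (simp add: algebra_simps)
  qed
  define g where "g = T (x b) \<bullet> u"
  \<comment> \<open>The derivative of \<open>exp t * (x t \<bullet> u - g)\<close> is at least
    \<open>- exp t * L * (b - t)\<close> by \<open>Lip\<close>. The summand
    \<open>L * (b - t) + L\<close> compensates this, since \<open>exp t * (L * (b - t) + L)\<close>
    has derivative \<open>exp t * L * (b - t)\<close>.\<close>
  have "exp a * (x a \<bullet> u - g + L * (b - a) + L) \<le> exp b * (x b \<bullet> u - g + L * (b - b) + L)"
  proof (rule DERIV_nonneg_imp_increasing_open[of a b "\<lambda>t. exp t * (x t \<bullet> u - g + L * (b - t) + L)"])
    fix t assume t: "a < t" "t < b"
    have "((\<lambda>t. exp t * (x t \<bullet> u - g + L * (b - t) + L)) has_real_derivative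
             exp t * (T (x t) \<bullet> u - g + L * (b - t))) (at t)"
      using t assms(1) by (auto intro!: derivative_eq_intros flow_inner simp: algebra_simps)
    moreover have "g - T (x t) \<bullet> u \<le> L * (b - t)"
      using u(2)[of "T (x b) - T (x t)"] nonexpansive[of "x b" "x t"] Lip[of t] t
      by (auto simp: g_def inner_diff_left)
    ultimately show "\<exists>D. ((\<lambda>t. exp t * (x t \<bullet> u - g + L * (b - t) + L)) has_real_derivative D) (at t) \<and> D \<ge> 0"
      by (auto intro!: exI mult_nonneg_nonneg)
  qed (use assms in \<open>auto intro!: continuous_intros cx\<close>)
  moreover have "exp b = exp a * exp (b - a)" by (simp flip: exp_add)
  ultimately have "exp a * (x a \<bullet> u - g + L * (b - a) + L) \<le> exp a * (exp (b - a) * (x b \<bullet> u - g + L))"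
    by (simp only: mult.assoc) simp
  then have "x a \<bullet> u - g + L * (b - a) + L \<le> exp (b - a) * (x b \<bullet> u - g + L)"
    by simp
  moreover have "g = x b \<bullet> u + d b" using u(1) by (simp add: g_def inner_diff_left)
  ultimately have "L * (b - a) + (L - d b) - (x b - x a) \<bullet> u \<le> exp (b - a) * (L - d b)"
    by (simp add: inner_diff_left)
  \<comment> \<open>This allows the nonnegative summand \<open>L - d b\<close> on the left to be
    dropped.\<close>
  moreover have "d b \<le> L" using speed_antimono assms by (auto simp: L_def d_def)
  ultimately show ?thesis using u(2)[of "x b - x a"] by (simp add: L_def)
qed

text \<open>With this, \<open>infnorm_diff_antimono\<close> says that the distance to a fixed point
  never increases.\<close>

lemma const_flow:
  assumes "T p = p" shows "nonexpansive_flow T (\<lambda>_. p)"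
  by unfold_locales (auto simp: nonexpansive assms)

text \<open>The given \<open>p\<close> keeps the trajectory bounded; the limit \<open>q\<close> may
  be a different fixed point.\<close>

lemma tendsto_fixed_point:
  assumes "T p = p"
  obtains q where "T q = q" "(x \<longlongrightarrow> q) at_top"
proof -
  define R where "R = infnorm (x 0 - p)"
  define d where "d t = infnorm (T (x t) - x t)" for t
  have R: "infnorm (x t - p) \<le> R" if "t \<ge> 0" for t
    using infnorm_diff_antimono[OF const_flow, of p 0 t] assms that by (simp add: R_def)
  have "decseq (\<lambda>n. d (real n))"
    unfolding d_def by (intro decseq_SucI speed_antimono) auto
  then obtain r where r: "(\<lambda>n. d (real n)) \<longlonglongrightarrow> r"
    by (rule decseq_convergent[of _ 0]) (auto simp: d_def infnorm_pos_le)
  \<comment> \<open>For a fixed window length \<open>k\<close>, the exponential error term vanishes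
    as \<open>n\<close> grows, because \<open>d n\<close> and \<open>d (n + k)\<close> have the same
    limit. Both ends of the window lie within \<open>R\<close> of \<open>p\<close>, so the
    displacement stays below \<open>2 * R\<close>. Letting \<open>k\<close> grow then excludes
    \<open>r > 0\<close>.\<close>
  have "r * real k \<le> 2 * R" for k
  proof (rule LIMSEQ_le_const2)
    show "(\<lambda>n. d (real n) * real k - exp (real k) * (d (real n) - d (real (n + k)))) \<longlonglongrightarrow> r * real k"
      using tendsto_diff[OF tendsto_mult_right[OF r] tendsto_mult_left[OF
          tendsto_diff[OF r LIMSEQ_ignore_initial_segment[OF r]]], of "real k" "exp (real k)" k]
      by simp
    have "infnorm (x (real (n + k)) - x (real n)) \<le> 2 * R" for n
      using infnorm_triangle[of "x (real (n + k)) - p" "p - x (real n)"] R[of "real n"] R[of "real (n + k)"]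
      by (simp add: infnorm_sub[of p])
    moreover have "d (real n) * real k - exp (real k) * (d (real n) - d (real (n + k)))
        \<le> infnorm (x (real (n + k)) - x (real n))" for n
      using displacement_ge[of "real n" "real (n + k)"] by (simp add: d_def)
    ultimately show "\<exists>N. \<forall>n\<ge>N. d (real n) * real k - exp (real k) * (d (real n) - d (real (n + k))) \<le> 2 * R"
      using order_trans by blast
  qed
  then have "r \<le> 0"
    using reals_Archimedean3[of r] by (metis not_le mult.commute)
  moreover have "r \<ge> 0"
    by (rule LIMSEQ_le_const[OF r]) (auto simp: d_def infnorm_pos_le)
  ultimately have d0: "(\<lambda>n. d (real n)) \<longlonglongrightarrow> 0" using r by simp
  have "norm (x (real n) - p) \<le> sqrt DIM('a) * R" for n
    using norm_le_infnorm[of "x (real n) - p"] R[of "real n"]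
    by (meson mult_left_mono of_nat_0_le_iff order_trans real_sqrt_ge_zero)
  then have "bounded (range (\<lambda>n. x (real n)))"
    by (auto simp: bounded_def dist_norm norm_minus_commute)
  then obtain q s where s: "strict_mono s" and q: "((\<lambda>n. x (real n)) \<circ> s) \<longlonglongrightarrow> q"
    using bounded_imp_convergent_subsequence by blast
  have "(\<lambda>n. T (x (real (s n)))) \<longlonglongrightarrow> T q"
    using continuous_on_infnorm_Lipschitz[OF nonexpansive, of UNIV] q
    by (auto intro: continuous_on_tendsto_compose simp: o_def)
  then have "(\<lambda>n. d (real (s n))) \<longlonglongrightarrow> infnorm (T q - q)"
    unfolding d_def using q by (intro tendsto_intros) (simp_all add: o_def)
  moreover have "(\<lambda>n. d (real (s n))) \<longlonglongrightarrow> 0"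
    using LIMSEQ_subseq_LIMSEQ[OF d0 s] by (simp add: o_def)
  ultimately have "infnorm (T q - q) = 0" using LIMSEQ_unique by blast
  then have fixed: "T q = q" by (simp add: infnorm_eq_0)
  have "(\<lambda>n. infnorm (x (real (s n)) - q)) \<longlonglongrightarrow> infnorm (q - q)"
    using q by (intro tendsto_intros) (simp add: o_def)
  then have lim: "(\<lambda>n. infnorm (x (real (s n)) - q)) \<longlonglongrightarrow> 0" by (simp add: infnorm_0)
  \<comment> \<open>Since \<open>q\<close> is fixed, closeness at one time \<open>s n\<close>
    persists at all later times, which upgrades subsequential to full convergence. The factor bounds
    the Euclidean norm by the maximum norm.\<close>
  have "((\<lambda>t. sqrt DIM('a) * infnorm (x t - q)) \<longlongrightarrow> 0) at_top"
  proof (intro tendsto_mult_right_zero tendstoI)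
    fix e :: real assume "e > 0"
    then obtain n where n: "infnorm (x (real (s n)) - q) < e"
      using eventually_happens'[OF sequentially_bot order_tendstoD(2)[OF lim]] by blast
    have "infnorm (x t - q) < e" if "t \<ge> real (s n)" for t
      using infnorm_diff_antimono[OF const_flow[OF fixed], of "real (s n)" t] that n by simp
    then show "\<forall>\<^sub>F t in at_top. dist (infnorm (x t - q)) 0 < e"
      by (intro eventually_at_top_linorderI[of "real (s n)"]) (simp add: infnorm_pos_le)
  qed
  then have "((\<lambda>t. x t - q) \<longlongrightarrow> 0) at_top"
    by (rule Lim_null_comparison[rotated]) (simp add: norm_le_infnorm)
  then have "(x \<longlongrightarrow> q) at_top" by (simp add: LIM_zero_iff)
  with fixed show thesis by (rule that)
qed

end

section \<open>Best allocations and partners\<close>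

lemma infnorm_le_cart:
  fixes v :: "real^'n"
  assumes "\<And>i. \<bar>v $ i\<bar> \<le> c"
  shows "infnorm v \<le> c"
  unfolding infnorm_cart by (rule cSup_least) (use assms in auto)

lemma best_allocation_le:
  assumes "\<And>k. k \<in> neighbors E i \<Longrightarrow> max 0 (w i k - x $ k) \<le> c" "0 \<le> c"
  shows "best_allocation E w i j x \<le> c"
  using assms by (auto simp: best_allocation_def)

lemma best_allocation_ge:
  assumes "k \<in> neighbors E i" "k \<noteq> j"
  shows "max 0 (w i k - x $ k) \<le> best_allocation E w i j x"
proof -
  have "k \<in> neighbors E i - {j}" using assms by auto
  then have "max 0 (w i k - x $ k) \<le> Max ((\<lambda>k. max 0 (w i k - x $ k)) ` (neighbors E i - {j}))"
    by (intro Max_ge) auto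
  with assms show ?thesis by (auto simp: best_allocation_def)
qed

lemma best_allocation_nonneg: "0 \<le> best_allocation E w i j x"
proof (cases "neighbors E i - {j} = {}")
  case False
  then obtain k where "k \<in> neighbors E i" "k \<noteq> j" by auto
  from best_allocation_ge[OF this, of w x] show ?thesis by linarith
qed (simp add: best_allocation_def)

text \<open>Each term \<open>max 0 (w i k - x $ k)\<close> is 1-Lipschitz in the single coordinate
  \<open>x $ k\<close>, and a maximum of such terms inherits the bound.\<close>

lemma best_allocation_le_add:
  "best_allocation E w i j x \<le> best_allocation E w i j y + infnorm (x - y)"
proof (cases "neighbors E i - {j} = {}")
  case False
  have "max 0 (w i k - x $ k) \<le> best_allocation E w i j y + infnorm (x - y)"
    if "k \<in> neighbors E i - {j}" for k
    using best_allocation_ge[of k E i j w y] component_le_infnorm_cart[of "x - y" k] that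
    by auto
  with False show ?thesis by (simp add: best_allocation_def[of _ _ _ _ x])
qed (simp add: best_allocation_def infnorm_pos_le)

lemma best_allocation_nonexpansive:
  "\<bar>best_allocation E w i j x - best_allocation E w i j y\<bar> \<le> infnorm (x - y)"
  using best_allocation_le_add[of E w i j x y] best_allocation_le_add[of E w i j y x]
  by (simp add: infnorm_sub[of y])

text \<open>Two edges of a matching that share \<open>i\<close> coincide, so the definite
  description in \<open>partner\<close> is justified.\<close>

lemma partner_eq:
  assumes "is_matching E M" "\<And>e. e \<in> E \<Longrightarrow> card e = 2" "{i, j} \<in> M"
  shows "partner M i = j"
proof -
  have "k = j" if "{i, k} \<in> M" for k
  proof -
    have "\<not> disjnt {i, k} {i, j}" by (simp add: disjnt_def)
    then have "{i, k} = {i, j}"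
      using assms(1,3) that pairwiseD unfolding is_matching_def by metis
    moreover have "card {i, k} = 2" using assms that by (auto simp: is_matching_def)
    ultimately show ?thesis by (auto simp: doubleton_eq_iff)
  qed
  with assms(3) show ?thesis unfolding partner_def by (rule the_equality)
qed

lemma matched_iff:
  assumes "is_matching E M" "\<And>e. e \<in> E \<Longrightarrow> card e = 2"
  shows "i \<in> \<Union>M \<longleftrightarrow> (\<exists>j. {i, j} \<in> M)"
proof
  assume "i \<in> \<Union>M"
  then obtain e where e: "e \<in> M" "i \<in> e" by auto
  then have "card e = 2" using assms by (auto simp: is_matching_def)
  with e show "\<exists>j. {i, j} \<in> M" by (auto simp: card_2_iff insert_commute)
qed auto

section \<open>The rebalancing map and its fixed points\<close>

text \<open>On a matched pair this is the Nash bargaining split of the edge weight, with the two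
  best allocations as disagreement values.\<close>

definition rebalance ::
    "'n::finite set set \<Rightarrow> ('n \<Rightarrow> 'n \<Rightarrow> real) \<Rightarrow> 'n set set \<Rightarrow> real^'n \<Rightarrow> real^'n" where
  "rebalance E w M x = x - balancing_error E w M x"

lemma rebalance_nth:
  "rebalance E w M x $ i =
     (if i \<in> \<Union>M
      then 1/2 * (w i (partner M i) + best_allocation E w i (partner M i) x
                    - best_allocation E w (partner M i) i x)
      else 0)"
  by (simp add: rebalance_def balancing_error_def Let_def)

lemma rebalance_nonexpansive:
  "infnorm (rebalance E w M x - rebalance E w M y) \<le> infnorm (x - y)"
proof (rule infnorm_le_cart)
  fix i
  let ?j = "partner M i"
  show "\<bar>(rebalance E w M x - rebalance E w M y) $ i\<bar> \<le> infnorm (x - y)"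
    using best_allocation_nonexpansive[of E w i ?j x y] best_allocation_nonexpansive[of E w ?j i x y]
      infnorm_pos_le[of "x - y"]
    by (simp add: rebalance_nth) argo
qed

lemma rebalance_fixed_point_exists:
  fixes E :: "'n::finite set set"
  shows "\<exists>x. rebalance E w M x = x"
proof -
  \<comment> \<open>All pairs and absolute values are taken because neither a graph nor a matching
    is assumed here, so \<open>w\<close> may be negative and \<open>partner\<close>
    arbitrary.\<close>
  define W where "W = Max (range (\<lambda>(i, j). \<bar>w i j\<bar>))"
  have W: "\<bar>w i j\<bar> \<le> W" for i j
    unfolding W_def by (rule Max_ge) (auto intro!: image_eqI[of _ _ "(i, j)"])
  \<comment> \<open>The radius reproduces itself: states of at least \<open>- 2 * W\<close> give
    allocations of at most \<open>W + 2 * W\<close>, and half of \<open>W + 3 * W\<close> is again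
    \<open>2 * W\<close>.\<close>
  let ?C = "cbox (\<chi> i. - 2 * W) (\<chi> i. 2 * W) :: (real^'n) set"
  have W0: "0 \<le> W" using W[of undefined undefined] by linarith
  \<comment> \<open>On \<open>?C\<close> allocations lie between \<open>0\<close> and \<open>3 * W\<close>, and only their half difference enters.\<close>
  have "\<bar>rebalance E w M x $ i\<bar> \<le> 2 * W" if "x \<in> ?C" for x i
  proof -
    have bound: "best_allocation E w k l x \<le> 3 * W" for k l
    proof (rule best_allocation_le)
      fix m show "max 0 (w k m - x $ m) \<le> 3 * W"
        using W[of k m] W0 that by (auto simp: mem_box_cart dest!: spec[of _ m])
    qed (use W0 in simp)
    let ?j = "partner M i"
    show ?thesis
      using bound[of i ?j] bound[of ?j i] W[of i ?j] W0 best_allocation_nonneg[of E w i ?j x]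
        best_allocation_nonneg[of E w ?j i x]
      by (simp add: rebalance_nth) argo
  qed
  then have maps: "rebalance E w M \<in> ?C \<rightarrow> ?C" by (auto simp: mem_box_cart abs_le_iff minus_le_iff)
  have "0 \<in> ?C" using W0 by (simp add: mem_box_cart)
  then have nonempty: "?C \<noteq> {}" by (metis empty_iff)
  have cont: "continuous_on ?C (rebalance E w M)"
    by (rule continuous_on_infnorm_Lipschitz) (rule rebalance_nonexpansive)
  obtain x where "x \<in> ?C" "rebalance E w M x = x"
    by (rule brouwer[OF compact_cbox convex_box(1) nonempty cont maps])
  then show ?thesis by (intro exI)
qed

text \<open>For a matched pair, adding the two fixed-point equations cancels the allocations and
  leaves the edge weight; subtracting them cancels the weight and leaves the balance condition. Both
  use the symmetry of \<open>w\<close>.\<close>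

lemma balanced_outcome_fixed_point:
  assumes G: "weighted_graph E w" and M: "is_matching E M" and fixed: "rebalance E w M x = x"
  shows "balanced_outcome E w M x"
proof -
  have card: "\<And>e. e \<in> E \<Longrightarrow> card e = 2" using G by (auto simp: weighted_graph_def)
  have unmatched: "x $ k = 0" if "k \<notin> \<Union>M" for k
    using arg_cong[OF fixed, of "\<lambda>v. v $ k"] that by (simp add: rebalance_nth)
  have partner: "partner M i = j" "i \<in> \<Union>M" if "{i, j} \<in> M" for i j
    using partner_eq[OF M card that] that by auto
  have eq: "x $ i = 1/2 * (w i j + best_allocation E w i j x - best_allocation E w j i x)"
    if "{i, j} \<in> M" for i j
    using arg_cong[OF fixed, of "\<lambda>v. v $ i"] partner[OF that]
    by (simp only: rebalance_nth if_True)
  have "w i j = w j i \<and> x $ i + x $ j = w i j \<and>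
      best_allocation E w i j x - x $ i = best_allocation E w j i x - x $ j" if "{i, j} \<in> M" for i j
  proof -
    have "w i j = w j i" using G M that by (auto simp: weighted_graph_def is_matching_def)
    with eq[OF that] eq[of j i] that show ?thesis by (simp add: insert_commute)
  qed
  then show ?thesis using unmatched M by (auto simp: balanced_outcome_def outcome_def)
qed

section \<open>Two-hop locality\<close>

lemma best_allocation_cong:
  assumes "\<And>k. k \<in> neighbors E i \<Longrightarrow> w i k = w' i k \<and> x $ k = y $ k"
  shows "best_allocation E w i j x = best_allocation E w' i j y"
  unfolding best_allocation_def using assms
  by (intro if_cong refl arg_cong[of _ _ Max] image_cong) auto

text \<open>A best allocation reads only the weights and states at the neighbors of its agent. The
  error of a matched \<open>i\<close> involves those of \<open>i\<close> and of its partner; the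
  partner is a neighbor of \<open>i\<close>, so its own neighbors are within two hops.\<close>

lemma balancing_error_distributed:
  "distributed_two_hop E (\<lambda>w M x. - balancing_error E w M x)"
  unfolding distributed_two_hop_def
proof (intro allI impI)
  fix i w w' M M' and x y :: "real^'a"
  assume G: "weighted_graph E w" and M: "is_matching E M" and M': "is_matching E M'"
    and w: "\<forall>j\<in>neighbors E i. w i j = w' i j \<and> (\<forall>k\<in>neighbors E j. w j k = w' j k)"
    and MM': "\<forall>j. ({i, j} \<in> M) = ({i, j} \<in> M')"
    and x: "\<forall>k\<in>{i} \<union> neighbors E i \<union> two_hop_neighbors E i. x $ k = y $ k"
  have card: "\<And>e. e \<in> E \<Longrightarrow> card e = 2" using G by (auto simp: weighted_graph_def)
  have matched: "i \<in> \<Union>M \<longleftrightarrow> i \<in> \<Union>M'"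
    using matched_iff[OF M card] matched_iff[OF M' card] MM' by simp
  have xi: "x $ i = y $ i" using x by simp
  show "(- balancing_error E w M x) $ i = (- balancing_error E w' M' y) $ i"
  proof (cases "i \<in> \<Union>M")
    case True
    then obtain j where j: "{i, j} \<in> M" using matched_iff[OF M card] by auto
    then have nb: "j \<in> neighbors E i" using M by (auto simp: is_matching_def neighbors_def)
    have "partner M i = j" "partner M' i = j"
      using partner_eq[OF M card] partner_eq[OF M' card] j MM' by auto
    moreover have "w i j = w' i j" using w nb by auto
    moreover have "best_allocation E w i j x = best_allocation E w' i j y"
      using w x by (intro best_allocation_cong) auto
    moreover have "best_allocation E w j i x = best_allocation E w' j i y"
      using w x nb by (intro best_allocation_cong) (auto simp: two_hop_neighbors_def)
    ultimately show ?thesis using True matched xi by (simp add: balancing_error_def)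
  qed (use matched xi in \<open>simp add: balancing_error_def\<close>)
qed

theorem propositionV3:
  fixes E M :: "'n::finite set set"
    and w :: "'n \<Rightarrow> 'n \<Rightarrow> real"
    and \<alpha>0 :: "real^'n"
    and \<alpha> :: "real \<Rightarrow> real^'n"
  assumes "weighted_graph E w"
    and "is_matching E M"
    and "trajectory (\<lambda>x. - balancing_error E w M x) \<alpha>0 \<alpha>"
  shows "(\<exists>\<alpha>_lim. (\<alpha> \<longlongrightarrow> \<alpha>_lim) at_top \<and> balanced_outcome E w M \<alpha>_lim) \<and>
         distributed_two_hop E (\<lambda>w' M' x. - balancing_error E w' M' x)"
proof -
  interpret nonexpansive_flow "rebalance E w M" \<alpha>
    using assms(3)
    by unfold_locales (rule rebalance_nonexpansive, simp add: trajectory_def rebalance_def)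
  obtain p where "rebalance E w M p = p" using rebalance_fixed_point_exists by blast
  then obtain q where "rebalance E w M q = q" "(\<alpha> \<longlongrightarrow> q) at_top"
    by (rule tendsto_fixed_point)
  with assms(1,2) show ?thesis
    using balanced_outcome_fixed_point balancing_error_distributed by blast
qed

end
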